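(* For the disk priority evacuation problem with $k$ Servants (defined in the context), every feasible solution has evacuation cost at least $4.64666$ when $k=1$, and at least $3.65332$ when $k=2$.
   Context: A unit speed trajectory is a map $\tau:\mathbb{R}_{\ge 0}\to\mathbb{R}^2$ with $\|\tau(t_1)-\tau(t_2)\|_2\le |t_1-t_2|$ for all $t_1,t_2\ge0$. In the disk priority evacuation problem with $k$ Servants there are $k+1$ agents labeled $0,\dots,k$ (agent $0$ is the Queen), moving along unit speed trajectories $\tau_0,\dots,\tau_k$ with $\tau_i(0)=(0,0)$ for all $i$. For $\theta\in[0,2\pi)$ let $P_\theta=(\cos\theta,\sin\theta)$. A solution is feasible if for every $\theta$ there exist an agent $i$ and a time $t'$ with $\tau_i(t')=P_\theta$; let $T(\theta)$ be the smallest such $t'$. The evacuation cost is $\sup_{\theta\in[0,2\pi)}\{T(\theta)+\|P_\theta-\tau_0(T(\theta))\|_2\}$. *)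

theory Defs
  imports "HOL-Analysis.Analysis"
begin

text \<open>
  Trajectories are functions on all of \<^typ>\<open>real\<close>, constrained and inspected only at times
  \<open>t \<ge> 0\<close>; likewise only the agents \<open>0, \<dots>, k\<close> of a family indexed by \<^typ>\<open>nat\<close> are relevant.
\<close>

definition unit_speed :: "(real \<Rightarrow> real ^ 2) \<Rightarrow> bool" where
  "unit_speed \<tau> \<longleftrightarrow> (\<forall>t1\<ge>0. \<forall>t2\<ge>0. norm (\<tau> t1 - \<tau> t2) \<le> \<bar>t1 - t2\<bar>)"

definition circle_point :: "real \<Rightarrow> real ^ 2" where
  "circle_point \<theta> = vector [cos \<theta>, sin \<theta>]"

definition evac_solution :: "nat \<Rightarrow> (nat \<Rightarrow> real \<Rightarrow> real ^ 2) \<Rightarrow> bool" where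
  "evac_solution k \<tau> \<longleftrightarrow> (\<forall>i\<le>k. unit_speed (\<tau> i) \<and> \<tau> i 0 = 0)"

definition visited_at :: "nat \<Rightarrow> (nat \<Rightarrow> real \<Rightarrow> real ^ 2) \<Rightarrow> real \<Rightarrow> real \<Rightarrow> bool" where
  "visited_at k \<tau> \<theta> t \<longleftrightarrow> 0 \<le> t \<and> (\<exists>i\<le>k. \<tau> i t = circle_point \<theta>)"

definition feasible :: "nat \<Rightarrow> (nat \<Rightarrow> real \<Rightarrow> real ^ 2) \<Rightarrow> bool" where
  "feasible k \<tau> \<longleftrightarrow> evac_solution k \<tau> \<and> (\<forall>\<theta>\<in>{0..<2 * pi}. \<exists>t. visited_at k \<tau> \<theta> t)"

definition visit_time :: "nat \<Rightarrow> (nat \<Rightarrow> real \<Rightarrow> real ^ 2) \<Rightarrow> real \<Rightarrow> real" where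
  "visit_time k \<tau> \<theta> = (LEAST t. visited_at k \<tau> \<theta> t)"

text \<open>
  The supremum is taken in \<^typ>\<open>ereal\<close>: a feasible solution may have unbounded visit times, and
  then its cost is \<open>\<infinity>\<close>.
\<close>

definition evac_cost :: "nat \<Rightarrow> (nat \<Rightarrow> real \<Rightarrow> real ^ 2) \<Rightarrow> ereal" where
  "evac_cost k \<tau> =
     (SUP \<theta>\<in>{0..<2 * pi}.
        ereal (visit_time k \<tau> \<theta> + norm (circle_point \<theta> - \<tau> 0 (visit_time k \<tau> \<theta>))))"

text \<open>The least visit time exists, so the \<open>LEAST\<close> above is never a junk value.\<close>

lemma unit_speed_continuous_on:
  assumes "unit_speed \<tau>"
  shows "continuous_on {0..} \<tau>"
proof -
  have "1-lipschitz_on {0..} \<tau>"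
    using assms by (auto simp: lipschitz_on_def unit_speed_def dist_norm)
  then show ?thesis
    by (rule lipschitz_on_continuous_on)
qed

lemma visit_time_least:
  assumes "feasible k \<tau>" and "\<theta> \<in> {0..<2 * pi}"
  shows "visited_at k \<tau> \<theta> (visit_time k \<tau> \<theta>)"
    and "\<And>t. visited_at k \<tau> \<theta> t \<Longrightarrow> visit_time k \<tau> \<theta> \<le> t"
proof -
  let ?S = "{t. visited_at k \<tau> \<theta> t}"
  have "closed {t \<in> {0..}. \<tau> i t = circle_point \<theta>}" if "i \<le> k" for i
  proof -
    have "continuous_on {0..} (\<tau> i)"
      using assms(1) that by (auto simp: feasible_def evac_solution_def intro: unit_speed_continuous_on)
    then show ?thesis
      using continuous_closed_preimage_constant[of "{0..}" "\<tau> i"] by simp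
  qed
  then have "closed (\<Union>i\<in>{..k}. {t \<in> {0..}. \<tau> i t = circle_point \<theta>})"
    by (intro closed_UN) auto
  also have "(\<Union>i\<in>{..k}. {t \<in> {0..}. \<tau> i t = circle_point \<theta>}) = ?S"
    by (auto simp: visited_at_def)
  finally have "closed ?S" .
  moreover have "?S \<noteq> {}"
    using assms by (auto simp: feasible_def)
  moreover have bdd: "bdd_below ?S"
    by (rule bdd_belowI[of _ 0]) (auto simp: visited_at_def)
  ultimately have "Inf ?S \<in> ?S"
    by (intro closed_contains_Inf)
  then have *: "visited_at k \<tau> \<theta> (Inf ?S)"
    by simp
  have low: "Inf ?S \<le> t" if "visited_at k \<tau> \<theta> t" for t
    using that bdd by (intro cInf_lower) auto
  have "visit_time k \<tau> \<theta> = Inf ?S"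
    unfolding visit_time_def by (rule Least_equality) (use * low in auto)
  with * low show "visited_at k \<tau> \<theta> (visit_time k \<tau> \<theta>)"
    and "\<And>t. visited_at k \<tau> \<theta> t \<Longrightarrow> visit_time k \<tau> \<theta> \<le> t"
    by auto
qed

end

theory Submission
  imports Defs "HOL-Real_Asymp.Real_Asymp"
begin

text \<open>
  By time \<open>t\<close> the \<open>k + 1\<close> agents have seen an arc length of at most \<open>(k + 1) (t - 1)\<close>. If this is less
  than \<open>2 \<pi> / n\<close>, some regular \<open>n\<close>-gon has no vertex visited before \<open>t\<close>; a pigeonhole argument on a
  fine regular \<open>n m\<close>-gon replaces arc length by counting. The bounds come from \<open>n = 12\<close>.

  Suppose the cost is less than \<open>C\<close>. As long as a point is unvisited at time \<open>s\<close>, the Queen is within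
  \<open>C - s\<close> of it. For two vertices at distance \<open>d\<close>, first visited at times \<open>x \<le> y\<close>, this yields
  \<open>x + d < C\<close> if the Queen makes the first visit, \<open>2 x + d < C + y\<close> if she makes the second one, and
  \<open>2 x + d < 2 C\<close> always; moreover \<open>y - x \<ge> d\<close> if the same agent makes both visits. These linear
  constraints on the twelve visit times already have no solution. Since every agent has time only for a
  short tour of the vertices, few orders of visits are possible, and a verified search refutes them all.
\<close>

subsection \<open>Counting\<close>

definition ceil_div :: "nat \<Rightarrow> nat \<Rightarrow> nat" where
  "ceil_div m n = (m + n - 1) div n"

lemma ceil_div_le_iff:
  assumes "0 < n"
  shows "ceil_div m n \<le> q \<longleftrightarrow> m \<le> q * n"
proof -
  have "ceil_div m n \<le> q \<longleftrightarrow> m + n - 1 < Suc q * n"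
    unfolding ceil_div_def less_Suc_eq_le[symmetric] by (rule div_less_iff_less_mult[OF assms])
  also have "\<dots> \<longleftrightarrow> m \<le> q * n"
    using assms by auto
  finally show ?thesis .
qed

lemma pigeonhole_ceil_div:
  assumes "finite A" "finite B" "B \<noteq> {}" "\<And>x. x \<in> A \<Longrightarrow> f x \<in> B"
  shows "\<exists>y\<in>B. ceil_div (card A) (card B) \<le> card {x \<in> A. f x = y}"
proof -
  obtain y where "y \<in> B" "card A \<le> card (f -` {y} \<inter> A) * card B"
    using pigeonhole_card[of f A B] assms by auto
  moreover have "f -` {y} \<inter> A = {x \<in> A. f x = y}"
    by auto
  ultimately show ?thesis
    using assms(2,3) by (auto simp: ceil_div_le_iff card_gt_0_iff)
qed

lemma ex_missed_residue:
  fixes A :: "nat set"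
  assumes "finite A" "card A < m"
  shows "\<exists>j<m. \<forall>i\<in>A. i mod m \<noteq> j"
proof -
  have "card ((\<lambda>i. i mod m) ` A) < card {..<m}"
    using card_image_le[OF assms(1), of "\<lambda>i. i mod m"] assms(2) by simp
  then have "\<not> {..<m} \<subseteq> (\<lambda>i. i mod m) ` A"
    using card_mono[of "(\<lambda>i. i mod m) ` A" "{..<m}"] assms(1) by auto
  then show ?thesis
    by fastforce
qed

lemma card_separated_le:
  fixes X :: "'a \<Rightarrow> real"
  assumes "finite A" "A \<noteq> {}" "0 < \<delta>"
    and separated: "\<And>i j. i \<in> A \<Longrightarrow> j \<in> A \<Longrightarrow> i \<noteq> j \<Longrightarrow> \<delta> \<le> \<bar>X i - X j\<bar>"
    and bounds: "\<And>i. i \<in> A \<Longrightarrow> a \<le> X i" "\<And>i. i \<in> A \<Longrightarrow> X i \<le> b"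
  shows "(real (card A) - 1) * \<delta> \<le> b - a"
proof -
  let ?slot = "\<lambda>i. \<lfloor>(X i - a) / \<delta>\<rfloor>"
  have "inj_on ?slot A"
  proof (rule inj_onI, rule ccontr)
    fix i j assume ij: "i \<in> A" "j \<in> A" "?slot i = ?slot j" "i \<noteq> j"
    have "\<bar>(X i - a) / \<delta> - (X j - a) / \<delta>\<bar> < 1"
      using ij(3) by linarith
    then have "\<bar>X i - X j\<bar> < \<delta>"
      using assms(3) by (simp flip: diff_divide_distrib add: abs_divide)
    then show False
      using separated[OF ij(1,2,4)] by simp
  qed
  moreover have "?slot ` A \<subseteq> {0..\<lfloor>(b - a) / \<delta>\<rfloor>}"
    using assms(3) bounds by (auto intro!: floor_mono divide_right_mono)
  ultimately have "card A \<le> card {0..\<lfloor>(b - a) / \<delta>\<rfloor>}"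
    by (intro card_inj_on_le) auto
  moreover have "0 \<le> (b - a) / \<delta>"
    using assms(2,3) bounds by force
  ultimately have "real (card A) - 1 \<le> (b - a) / \<delta>"
    by (simp add: nat_le_iff) linarith
  then show ?thesis
    using assms(3) by (simp add: pos_le_divide_eq)
qed

lemma length_remove1_less: "x \<in> set xs \<Longrightarrow> length (remove1 x xs) < length xs"
  by (auto simp: length_remove1 intro: diff_less length_pos_if_in_set)

subsection \<open>Regular polygons\<close>

lemma circle_point_eq_iff: "circle_point \<alpha> = circle_point \<beta> \<longleftrightarrow> cos \<alpha> = cos \<beta> \<and> sin \<alpha> = sin \<beta>"
  by (auto simp: circle_point_def vec_eq_iff forall_2)

lemma ex_circle_point_eq: "\<exists>\<theta>'\<in>{0..<2 * pi}. circle_point \<theta>' = circle_point \<theta>"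
proof -
  obtain t where "0 \<le> t" "t < 2 * pi" "cos \<theta> = cos t" "sin \<theta> = sin t"
    using sincos_total_2pi[of "cos \<theta>" "sin \<theta>"] by (metis sin_cos_squared_add2)
  then show ?thesis
    by (intro bexI[of _ t]) (auto simp: circle_point_eq_iff)
qed

lemma norm_circle_point: "norm (circle_point \<theta>) = 1"
  by (simp add: circle_point_def norm_vec_def L2_set_def sum_2)

lemma norm_circle_point_diff:
  "norm (circle_point \<alpha> - circle_point \<beta>) = 2 * \<bar>sin ((\<alpha> - \<beta>) / 2)\<bar>"
proof -
  have half_angle: "cos (\<alpha> - \<beta>) = 1 - 2 * (sin ((\<alpha> - \<beta>) / 2))\<^sup>2"
    using cos_double_sin[of "(\<alpha> - \<beta>) / 2"] by (simp del: right_diff_distrib_numeral)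
  have "(norm (circle_point \<alpha> - circle_point \<beta>))\<^sup>2 = (cos \<alpha> - cos \<beta>)\<^sup>2 + (sin \<alpha> - sin \<beta>)\<^sup>2"
    by (simp add: circle_point_def norm_vec_def L2_set_def sum_2)
  also have "\<dots> = ((cos \<alpha>)\<^sup>2 + (sin \<alpha>)\<^sup>2) + ((cos \<beta>)\<^sup>2 + (sin \<beta>)\<^sup>2) - 2 * (cos \<alpha> * cos \<beta> + sin \<alpha> * sin \<beta>)"
    by (simp add: power2_eq_square algebra_simps)
  also have "\<dots> = 2 - 2 * cos (\<alpha> - \<beta>)"
    by (simp add: cos_diff)
  also have "\<dots> = (2 * \<bar>sin ((\<alpha> - \<beta>) / 2)\<bar>)\<^sup>2"
    by (simp add: half_angle power_mult_distrib)
  finally show ?thesis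
    by (rule power2_eq_imp_eq) auto
qed

definition polygon_angle :: "nat \<Rightarrow> real \<Rightarrow> nat \<Rightarrow> real" where
  "polygon_angle n \<phi> i = \<phi> + 2 * pi * real i / real n"

lemma polygon_angle_add: "polygon_angle n (polygon_angle n \<phi> j) i = polygon_angle n \<phi> (i + j)"
  by (simp add: polygon_angle_def algebra_simps add_divide_distrib)

lemma polygon_angle_mult: "0 < m \<Longrightarrow> polygon_angle (n * m) \<phi> (i * m) = polygon_angle n \<phi> i"
  by (simp add: polygon_angle_def)

lemma circle_point_polygon_angle_mod:
  assumes "0 < n"
  shows "circle_point (polygon_angle n \<phi> (i mod n)) = circle_point (polygon_angle n \<phi> i)"
proof -
  have "real i = real (i mod n) + real n * real (i div n)"
    by (metis mod_mult_div_eq of_nat_add of_nat_mult)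
  then have "polygon_angle n \<phi> i = polygon_angle n \<phi> (i mod n) + 2 * pi * real (i div n)"
    using assms by (simp add: polygon_angle_def field_simps)
  then show ?thesis
    using sin_2npi[of "i div n"] cos_2npi[of "i div n"]
    by (simp add: circle_point_eq_iff sin_add cos_add mult_ac)
qed

lemma norm_polygon_diff:
  assumes "i < n" "j < n"
  shows "norm (circle_point (polygon_angle n \<phi> i) - circle_point (polygon_angle n \<phi> j)) =
    2 * sin (pi * \<bar>real i - real j\<bar> / real n)"
proof -
  let ?x = "pi * (real i - real j) / real n"
  have abs_x: "\<bar>?x\<bar> = pi * (\<bar>real i - real j\<bar> / real n)"
    by (simp add: abs_mult)
  have "\<bar>real i - real j\<bar> / real n \<le> 1"
    using assms by (simp add: divide_le_eq)
  then have "\<bar>?x\<bar> \<le> pi"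
    unfolding abs_x using mult_left_mono[OF _ pi_ge_zero] by fastforce
  then have "0 \<le> sin \<bar>?x\<bar>"
    by (intro sin_ge_zero) auto
  then have "\<bar>sin ?x\<bar> = sin \<bar>?x\<bar>"
    by (simp add: abs_if split: if_splits)
  moreover have "(polygon_angle n \<phi> i - polygon_angle n \<phi> j) / 2 = ?x"
    by (simp add: polygon_angle_def algebra_simps diff_divide_distrib)
  ultimately show ?thesis
    by (simp only: norm_circle_point_diff abs_x times_divide_eq_right)
qed

lemma sin_polygon_side_le:
  fixes n :: nat and m :: real
  assumes "1 \<le> m" "m \<le> real n - 1"
  shows "sin (pi / n) \<le> sin (pi * m / n)"
proof -
  have first_half: "sin (pi / n) \<le> sin (pi * x / n)" if "1 \<le> x" "x \<le> real n / 2" for x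
  proof (rule sin_monotone_2pi_le)
    show "- (pi / 2) \<le> pi / n"
      by (rule order_trans[of _ 0]) auto
  qed (use that in \<open>auto simp: field_simps\<close>)
  show ?thesis
  proof (cases "m \<le> real n / 2")
    case True
    then show ?thesis
      using first_half assms(1) by blast
  next
    case False
    have "pi * (real n - m) / n = pi - pi * m / n"
      using assms by (simp add: field_simps)
    then show ?thesis
      using first_half[of "real n - m"] False assms(2) by simp
  qed
qed

lemma polygon_side_pos: "2 \<le> n \<Longrightarrow> 0 < sin (pi / real n)"
  by (intro sin_gt_zero) (auto simp: divide_less_eq)

lemma polygon_side_le:
  assumes "i < n" "j < n" "i \<noteq> j"
  shows "2 * sin (pi / n) \<le>
    norm (circle_point (polygon_angle n \<phi> i) - circle_point (polygon_angle n \<phi> j))"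
proof -
  have "1 \<le> \<bar>real i - real j\<bar>" "\<bar>real i - real j\<bar> \<le> real n - 1"
    using assms by linarith+
  then show ?thesis
    unfolding norm_polygon_diff[OF assms(1,2)] using sin_polygon_side_le by simp
qed

lemma ex_fine_polygon:
  assumes "0 < n" "c * s < 2 * pi / real n"
  shows "\<exists>m>0. c * (2 * sin (pi / real (n * m)) + s) < real m * (2 * sin (pi / real (n * m)))"
proof -
  define \<delta> where "\<delta> m = 2 * sin (pi / real (n * m))" for m
  have "\<delta> \<longlonglongrightarrow> 0" "(\<lambda>m. real m * \<delta> m) \<longlonglongrightarrow> 2 * pi / real n"
    unfolding \<delta>_def using assms(1) by (real_asymp simp: divide_inverse)+
  then have "(\<lambda>m. real m * \<delta> m - c * (\<delta> m + s)) \<longlonglongrightarrow> 2 * pi / real n - c * (0 + s)"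
    by (intro tendsto_intros)
  then have "\<forall>\<^sub>F m in sequentially. 0 < real m * \<delta> m - c * (\<delta> m + s)"
    by (rule order_tendstoD(1)) (use assms(2) in simp)
  then have "\<forall>\<^sub>F m in sequentially. 0 < m \<and> c * (\<delta> m + s) < real m * \<delta> m"
    using eventually_gt_at_top[of "0 :: nat"] by eventually_elim simp
  then show ?thesis
    unfolding \<delta>_def by (auto simp: eventually_sequentially)
qed

subsection \<open>Visit times of solutions\<close>

lemma visit_time_cong:
  "circle_point \<alpha> = circle_point \<beta> \<Longrightarrow> visit_time k \<tau> \<alpha> = visit_time k \<tau> \<beta>"
  by (simp add: visit_time_def visited_at_def)

locale feasible_solution =
  fixes k :: nat and \<tau> :: "nat \<Rightarrow> real \<Rightarrow> real ^ 2"
  assumes feasible: "feasible k \<tau>"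
begin

abbreviation T :: "real \<Rightarrow> real" where
  "T \<equiv> visit_time k \<tau>"

definition finder :: "real \<Rightarrow> nat" where
  "finder \<theta> = (SOME i. i \<le> k \<and> \<tau> i (T \<theta>) = circle_point \<theta>)"

lemma finder_cong: "circle_point \<alpha> = circle_point \<beta> \<Longrightarrow> finder \<alpha> = finder \<beta>"
  using visit_time_cong[of \<alpha> \<beta> k \<tau>] by (simp add: finder_def)

lemma start: "i \<le> k \<Longrightarrow> \<tau> i 0 = 0"
  using feasible by (auto simp: feasible_def evac_solution_def)

lemma speed: "i \<le> k \<Longrightarrow> 0 \<le> s \<Longrightarrow> 0 \<le> t \<Longrightarrow> norm (\<tau> i s - \<tau> i t) \<le> \<bar>s - t\<bar>"
  using feasible by (auto simp: feasible_def evac_solution_def unit_speed_def)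

lemma visited_T: "visited_at k \<tau> \<theta> (T \<theta>)"
proof -
  obtain \<theta>' where "\<theta>' \<in> {0..<2 * pi}" and eq: "circle_point \<theta>' = circle_point \<theta>"
    using ex_circle_point_eq by blast
  then have "visited_at k \<tau> \<theta>' (T \<theta>')"
    using visit_time_least(1)[OF feasible] by blast
  then show ?thesis
    using visit_time_cong[OF eq] eq by (simp add: visited_at_def)
qed

lemma T_nonneg: "0 \<le> T \<theta>"
  using visited_T by (simp add: visited_at_def)

lemma finder_le: "finder \<theta> \<le> k"
  and finder_visits: "\<tau> (finder \<theta>) (T \<theta>) = circle_point \<theta>"
proof -
  have "\<exists>i. i \<le> k \<and> \<tau> i (T \<theta>) = circle_point \<theta>"
    using visited_T by (auto simp: visited_at_def)
  from someI_ex[OF this] show "finder \<theta> \<le> k" "\<tau> (finder \<theta>) (T \<theta>) = circle_point \<theta>"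
    by (auto simp: finder_def)
qed

lemma T_ge_1: "1 \<le> T \<theta>"
  using speed[OF finder_le, of "T \<theta>" 0 \<theta>] start[OF finder_le] T_nonneg[of \<theta>]
  by (simp add: finder_visits norm_circle_point)

lemma dist_le_if_same_finder:
  assumes "finder \<alpha> = finder \<beta>"
  shows "norm (circle_point \<alpha> - circle_point \<beta>) \<le> \<bar>T \<alpha> - T \<beta>\<bar>"
  using speed[OF finder_le, of "T \<alpha>" "T \<beta>" \<alpha>] finder_visits[of \<alpha>] finder_visits[of \<beta>] T_nonneg assms
  by simp

lemma T_polygon_angle_mod: "0 < n \<Longrightarrow> T (polygon_angle n \<phi> (i mod n)) = T (polygon_angle n \<phi> i)"
  by (intro visit_time_cong circle_point_polygon_angle_mod)

lemma finder_polygon_angle_mod: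
  "0 < n \<Longrightarrow> finder (polygon_angle n \<phi> (i mod n)) = finder (polygon_angle n \<phi> i)"
  by (intro finder_cong circle_point_polygon_angle_mod)

lemma card_visited_before_le:
  assumes "1 \<le> t" "2 \<le> n"
  defines "\<delta> \<equiv> 2 * sin (pi / real n)"
  shows "real (card {i. i < n \<and> T (polygon_angle n \<phi> i) < t}) * \<delta> \<le> (real k + 1) * (\<delta> + (t - 1))"
proof -
  let ?A = "{i. i < n \<and> T (polygon_angle n \<phi> i) < t}"
  let ?B = "\<lambda>b. {i \<in> ?A. finder (polygon_angle n \<phi> i) = b}"
  have side_pos: "0 < \<delta>"
    unfolding \<delta>_def using polygon_side_pos[OF assms(2)] by simp
  have few: "real (card (?B b)) * \<delta> \<le> \<delta> + (t - 1)" for b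
  proof (cases "?B b = {}")
    case True
    then show ?thesis
      using side_pos assms(1) by (simp only: card.empty)
  next
    case False
    have "\<delta> \<le> \<bar>T (polygon_angle n \<phi> i) - T (polygon_angle n \<phi> j)\<bar>"
      if "i \<in> ?B b" "j \<in> ?B b" "i \<noteq> j" for i j
    proof -
      have "\<delta> \<le> norm (circle_point (polygon_angle n \<phi> i) - circle_point (polygon_angle n \<phi> j))"
        unfolding \<delta>_def using that by (intro polygon_side_le) auto
      also have "\<dots> \<le> \<bar>T (polygon_angle n \<phi> i) - T (polygon_angle n \<phi> j)\<bar>"
        using that by (intro dist_le_if_same_finder) simp
      finally show ?thesis .
    qed
    then have "(real (card (?B b)) - 1) * \<delta> \<le> t - 1"
      by (intro card_separated_le[where X = "\<lambda>i. T (polygon_angle n \<phi> i)"])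
        (use False side_pos T_ge_1 in auto)
    then show ?thesis
      by (simp add: algebra_simps)
  qed
  have "card ?A = card (\<Union>b\<le>k. ?B b)"
    by (rule arg_cong[where f = card]) (use finder_le in auto)
  also have "\<dots> \<le> (\<Sum>b\<le>k. card (?B b))"
    by (rule card_UN_le) simp
  finally have "real (card ?A) \<le> (\<Sum>b\<le>k. real (card (?B b)))"
    by (simp flip: of_nat_sum)
  then have "real (card ?A) * \<delta> \<le> (\<Sum>b\<le>k. real (card (?B b))) * \<delta>"
    using side_pos by (intro mult_right_mono) auto
  also have "\<dots> \<le> (\<Sum>b\<le>k. \<delta> + (t - 1))"
    unfolding sum_distrib_right by (intro sum_mono few)
  finally show ?thesis
    by (simp add: add.commute)
qed

lemma ex_unvisited_polygon:
  assumes "2 \<le> n" "1 \<le> t" "(real k + 1) * (t - 1) < 2 * pi / real n"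
  shows "\<exists>\<phi>. \<forall>i. t \<le> T (polygon_angle n \<phi> i)"
proof -
  obtain m where fine: "0 < m" "(real k + 1) * (2 * sin (pi / real (n * m)) + (t - 1)) <
      real m * (2 * sin (pi / real (n * m)))"
    using ex_fine_polygon[OF _ assms(3)] assms(1) by auto
  let ?ang = "polygon_angle (n * m) 0"
  let ?A = "{i. i < n * m \<and> T (?ang i) < t}"
  let ?\<delta> = "2 * sin (pi / real (n * m))"
  have "2 \<le> n * m"
    using assms(1) fine(1) mult_le_mono[of 2 n 1 m] by simp
  then have side_pos: "0 < ?\<delta>"
    using polygon_side_pos[OF \<open>2 \<le> n * m\<close>] by simp
  have "real (card ?A) * ?\<delta> < real m * ?\<delta>"
    using card_visited_before_le[OF assms(2) \<open>2 \<le> n * m\<close>] fine(2) by (rule order.strict_trans1)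
  then have "card ?A < m"
    using side_pos by simp
  then obtain j where missed: "j < m" "\<forall>i\<in>?A. i mod m \<noteq> j"
    using ex_missed_residue[of ?A m] by auto
  have "t \<le> T (polygon_angle n (?ang j) i)" for i
  proof -
    let ?i = "(i * m + j) mod (n * m)"
    have "?i mod m = j"
      using missed(1) mod_mod_cancel[of m "n * m" "i * m + j"] by simp
    then have "?i \<notin> ?A"
      using missed(2) by blast
    then have "t \<le> T (?ang ?i)"
      using assms(1) fine(1) by (simp add: not_less)
    also have "T (?ang ?i) = T (?ang (i * m + j))"
      using assms(1) fine(1) by (intro T_polygon_angle_mod) simp
    also have "?ang (i * m + j) = polygon_angle n (?ang j) i"
      using fine(1) by (simp flip: polygon_angle_add add: polygon_angle_mult)
    finally show ?thesis .
  qed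
  then show ?thesis
    by blast
qed

end

locale evacuation = feasible_solution +
  fixes C :: real
  assumes cost_less: "evac_cost k \<tau> < ereal C"
begin

lemma queen_dist_less: "T \<theta> + norm (circle_point \<theta> - \<tau> 0 (T \<theta>)) < C"
proof -
  obtain \<theta>' where \<theta>': "\<theta>' \<in> {0..<2 * pi}" and eq: "circle_point \<theta>' = circle_point \<theta>"
    using ex_circle_point_eq by blast
  have "ereal (T \<theta>' + norm (circle_point \<theta>' - \<tau> 0 (T \<theta>'))) \<le> evac_cost k \<tau>"
    unfolding evac_cost_def by (rule SUP_upper[OF \<theta>'])
  also note cost_less
  finally show ?thesis
    using eq visit_time_cong[OF eq] by simp
qed

lemma T_less: "T \<theta> < C"
  using queen_dist_less[of \<theta>] norm_ge_zero[of "circle_point \<theta> - \<tau> 0 (T \<theta>)"] by linarith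

lemma queen_dist_less_before:
  assumes "0 \<le> s" "s \<le> T \<theta>"
  shows "s + norm (circle_point \<theta> - \<tau> 0 s) < C"
proof -
  have "norm (circle_point \<theta> - \<tau> 0 s) \<le> norm (circle_point \<theta> - \<tau> 0 (T \<theta>)) + norm (\<tau> 0 (T \<theta>) - \<tau> 0 s)"
    using dist_triangle by (metis dist_norm)
  also have "norm (\<tau> 0 (T \<theta>) - \<tau> 0 s) \<le> T \<theta> - s"
    using speed[of 0 "T \<theta>" s] assms T_nonneg[of \<theta>] by simp
  finally show ?thesis
    using queen_dist_less[of \<theta>] by simp
qed

lemma dist_less_if_queen_first:
  assumes "finder \<alpha> = 0" "T \<alpha> \<le> T \<beta>"
  shows "T \<alpha> + norm (circle_point \<alpha> - circle_point \<beta>) < C"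
  using queen_dist_less_before[OF T_nonneg assms(2)] finder_visits[of \<alpha>] assms(1)
  by (simp add: norm_minus_commute)

lemma dist_less_if_queen_second:
  assumes "finder \<beta> = 0" "T \<alpha> \<le> T \<beta>"
  shows "2 * T \<alpha> + norm (circle_point \<alpha> - circle_point \<beta>) < C + T \<beta>"
proof -
  have "norm (circle_point \<alpha> - circle_point \<beta>) \<le>
      norm (circle_point \<alpha> - \<tau> 0 (T \<alpha>)) + norm (\<tau> 0 (T \<alpha>) - circle_point \<beta>)"
    using dist_triangle by (metis dist_norm)
  also have "norm (\<tau> 0 (T \<alpha>) - circle_point \<beta>) \<le> T \<beta> - T \<alpha>"
    using speed[of 0 "T \<alpha>" "T \<beta>"] finder_visits[of \<beta>] assms T_nonneg by simp
  finally show ?thesis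
    using queen_dist_less[of \<alpha>] by simp
qed

lemma dist_less_two_visits:
  "2 * min (T \<alpha>) (T \<beta>) + norm (circle_point \<alpha> - circle_point \<beta>) < 2 * C"
proof -
  let ?s = "min (T \<alpha>) (T \<beta>)"
  have "norm (circle_point \<alpha> - circle_point \<beta>) \<le>
      norm (circle_point \<alpha> - \<tau> 0 ?s) + norm (circle_point \<beta> - \<tau> 0 ?s)"
    using dist_triangle2 by (metis dist_norm)
  moreover have "0 \<le> ?s"
    using T_nonneg by simp
  ultimately show ?thesis
    using queen_dist_less_before[of ?s \<alpha>] queen_dist_less_before[of ?s \<beta>] by simp
qed

end

subsection \<open>Searching for a schedule\<close>

text \<open>
  A window \<open>(a, l, h)\<close> says that the Queen visits \<open>a\<close> during \<open>[l, h]\<close>, a visit \<open>(z, u)\<close> that some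
  Servant visits \<open>z\<close> at time \<open>u\<close> or later. A Servant visiting \<open>w\<close> at time \<open>t\<close> or later forbids the
  Queen to be at \<open>a\<close> between the times \<open>L - gap a w\<close> and \<open>2 t + gap a w - L\<close>.
\<close>

type_synonym 'v window = "'v \<times> int \<times> int"

type_synonym 'v visit = "'v \<times> int"

context
  fixes gap :: "'v \<Rightarrow> 'v \<Rightarrow> int" and \<delta> L :: int
begin

definition delay :: "'v \<Rightarrow> int \<Rightarrow> 'v window \<Rightarrow> 'v window" where
  "delay w t = (\<lambda>(a, l, h). (a, if l + gap a w \<le> L then l else max l (2 * t + gap a w - L), h))"

definition too_far :: "'v \<Rightarrow> int \<Rightarrow> 'v visit \<Rightarrow> bool" where
  "too_far w t = (\<lambda>(z, u). 2 * L < 2 * min t u + gap w z)"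

text \<open>
  Depth-first search over the orders in which \<open>n\<close> Servants visit the vertices \<open>R\<close>. The current
  Servant reaches \<open>v\<close> no earlier than \<open>earliest v\<close> and has to visit at least \<open>need\<close> more vertices;
  \<open>S\<close> lists the visits made so far. By the pigeonhole principle each new Servant may be chosen to take
  at least an equal share of the remaining vertices. The conditional, unlike a conjunction, passes
  \<open>1 < n\<close> on to the termination proof.
\<close>

function refute_servants ::
  "'v window list \<Rightarrow> 'v visit list \<Rightarrow> ('v \<Rightarrow> int) \<Rightarrow> nat \<Rightarrow> nat \<Rightarrow> 'v list \<Rightarrow> bool" where
  "refute_servants Q S earliest need n R \<longleftrightarrow>
     list_all (\<lambda>w. let t = earliest w in
       L < t + (int need - 1) * \<delta> \<or> list_ex (too_far w t) S \<or>
       (let Q' = map (delay w t) Q in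
         list_ex (\<lambda>(a, l, h). h < l) Q' \<or>
         refute_servants Q' ((w, t) # S) (\<lambda>v. t + gap w v) (need - 1) n (remove1 w R))) R \<and>
     (0 < need \<or>
       (if 1 < n then refute_servants Q S (\<lambda>v. 0) (ceil_div (length R) (n - 1)) (n - 1) R else False))"
  by pat_completeness auto
termination
  by (relation "measures [\<lambda>(Q, S, earliest, need, n, R). n, \<lambda>(Q, S, earliest, need, n, R). length R]")
    (auto simp: length_remove1_less)

declare refute_servants.simps [simp del]

lemma refute_servants_visitD:
  assumes "refute_servants Q S earliest need n R" "w \<in> set R"
  shows "L < earliest w + (int need - 1) * \<delta> \<or> list_ex (too_far w (earliest w)) S \<or>
    list_ex (\<lambda>(a, l, h). h < l) (map (delay w (earliest w)) Q) \<or>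
    refute_servants (map (delay w (earliest w)) Q) ((w, earliest w) # S) (\<lambda>v. earliest w + gap w v)
      (need - 1) n (remove1 w R)"
  using iffD1[OF refute_servants.simps assms(1)] assms(2) unfolding list_all_iff Let_def by blast

lemma refute_servants_nextD:
  assumes "refute_servants Q S earliest 0 n R"
  shows "1 < n" "refute_servants Q S (\<lambda>v. 0) (ceil_div (length R) (n - 1)) (n - 1) R"
  using iffD1[OF refute_servants.simps assms] by (auto split: if_splits)

definition advance :: "int \<Rightarrow> 'v window \<Rightarrow> 'v window" where
  "advance g = (\<lambda>(a, l, h). (a, l, h - g))"

text \<open>
  Depth-first search over the Queen's tours: she reaches \<open>c\<close> no earlier than \<open>t\<close> after the visits in
  \<open>Q\<close>, and the vertices \<open>R\<close> are left. A further step of length \<open>g\<close> lowers all earlier deadlines by \<open>g\<close>.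
\<close>

function refute_tours ::
  "nat \<Rightarrow> 'v window list \<Rightarrow> 'v \<Rightarrow> int \<Rightarrow> 'v list \<Rightarrow> bool" where
  "refute_tours k Q c t R \<longleftrightarrow>
     refute_servants ((c, t, L) # Q) [] (\<lambda>v. 0) (ceil_div (length R) k) k R \<and>
     list_all (\<lambda>w. let g = gap c w in
       L < t + g \<or>
       refute_tours k (map (advance g) ((c, t, L) # Q)) w (t + g) (remove1 w R)) R"
  by pat_completeness auto
termination
  by (relation "measures [\<lambda>(k, Q, c, t, R). length R]")
    (auto simp: length_remove1_less)

declare refute_tours.simps [simp del]

end

locale schedule =
  fixes gap :: "'v \<Rightarrow> 'v \<Rightarrow> int" and \<delta> L :: int
    and V :: "'v set" and k :: nat and time :: "'v \<Rightarrow> real" and agent :: "'v \<Rightarrow> nat"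
  assumes finite_V: "finite V"
    and gap_commute: "gap v w = gap w v"
    and \<delta>_pos: "0 < \<delta>"
    and gap_ge: "v \<in> V \<Longrightarrow> w \<in> V \<Longrightarrow> v \<noteq> w \<Longrightarrow> \<delta> \<le> gap v w"
    and agent_le: "agent v \<le> k"
    and time_nonneg: "v \<in> V \<Longrightarrow> 0 \<le> time v"
    and time_le: "v \<in> V \<Longrightarrow> time v \<le> L"
    and gap_le_if_same_agent: "v \<in> V \<Longrightarrow> w \<in> V \<Longrightarrow> agent v = agent w \<Longrightarrow> gap v w \<le> \<bar>time v - time w\<bar>"
    and gap_le_if_queen_first: "v \<in> V \<Longrightarrow> w \<in> V \<Longrightarrow> agent v = 0 \<Longrightarrow> time v \<le> time w \<Longrightarrow> time v + gap v w \<le> L"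
    and gap_le_if_queen_second: "v \<in> V \<Longrightarrow> w \<in> V \<Longrightarrow> agent w = 0 \<Longrightarrow> time v \<le> time w \<Longrightarrow>
      2 * time v + gap v w \<le> L + time w"
    and gap_le_two_visits: "v \<in> V \<Longrightarrow> w \<in> V \<Longrightarrow> 2 * min (time v) (time w) + gap v w \<le> 2 * L"
begin

lemma ex_first_visit:
  assumes "finite R" "r \<in> R" "agent r = b"
  obtains w where "w \<in> R" "agent w = b" "\<And>r. r \<in> R \<Longrightarrow> agent r = b \<Longrightarrow> time w \<le> time r"
proof -
  let ?B = "{r \<in> R. agent r = b}"
  have "finite ?B" "?B \<noteq> {}"
    using assms by auto
  then show ?thesis
    using that[of "arg_min_on time ?B"] arg_min_if_finite(1)[of ?B time] arg_min_least[of ?B _ time]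
    by simp
qed

lemma tour_time_le:
  fixes t :: int
  assumes "R \<subseteq> V" "w \<in> R" "agent w = b" "\<And>r. r \<in> R \<Longrightarrow> agent r = b \<Longrightarrow> t \<le> time r"
    and "n \<le> card {r \<in> R. agent r = b}"
  shows "t + (int n - 1) * \<delta> \<le> L"
proof -
  let ?B = "{r \<in> R. agent r = b}"
  have "real_of_int \<delta> \<le> \<bar>time i - time j\<bar>" if "i \<in> ?B" "j \<in> ?B" "i \<noteq> j" for i j
  proof -
    have ij: "i \<in> V" "j \<in> V" "agent i = agent j"
      using that assms(1) by auto
    then show ?thesis
      using gap_ge[OF ij(1,2) that(3)] gap_le_if_same_agent[OF ij] by linarith
  qed
  then have "(real (card ?B) - 1) * \<delta> \<le> real_of_int L - t"
    using finite_subset[OF assms(1) finite_V] assms(1-4) \<delta>_pos time_le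
    by (intro card_separated_le[where X = time]) auto
  moreover have "(real n - 1) * \<delta> \<le> (real (card ?B) - 1) * \<delta>"
    using assms(5) \<delta>_pos by (intro mult_right_mono) auto
  ultimately have "real_of_int (t + (int n - 1) * \<delta>) \<le> real_of_int L"
    by simp
  then show ?thesis
    by linarith
qed

lemma ex_queen_visit:
  assumes "0 < k" "V \<noteq> {}" "L < (int (ceil_div (card V) k) - 1) * \<delta>"
  shows "\<exists>v\<in>V. agent v = 0"
proof (rule ccontr)
  assume no_queen: "\<not> (\<exists>v\<in>V. agent v = 0)"
  have agents: "agent v \<in> {1..k}" if "v \<in> V" for v
    using no_queen that agent_le[of v] by (auto simp: Suc_le_eq)
  then obtain b where busy: "b \<in> {1..k}" "ceil_div (card V) k \<le> card {v \<in> V. agent v = b}"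
    using pigeonhole_ceil_div[OF finite_V, of "{1..k}" agent] agents assms(1) by auto
  have "0 < ceil_div (card V) k"
    using ceil_div_le_iff[OF assms(1), of "card V" 0] assms(2) finite_V by force
  then have "0 < card {v \<in> V. agent v = b}"
    using busy(2) by linarith
  then obtain w where "w \<in> V" "agent w = b"
    by (auto simp: card_gt_0_iff)
  then have "0 + (int (ceil_div (card V) k) - 1) * \<delta> \<le> L"
    using busy(2) time_nonneg by (intro tour_time_le) auto
  then show False
    using assms(3) by simp
qed

fun valid_window :: "'v window \<Rightarrow> bool" where
  "valid_window (a, l, h) \<longleftrightarrow> a \<in> V \<and> agent a = 0 \<and> l \<le> time a \<and> time a \<le> h"

fun valid_visit :: "'v visit \<Rightarrow> bool" where
  "valid_visit (z, u) \<longleftrightarrow> z \<in> V \<and> u \<le> time z"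

lemma valid_window_delay:
  assumes "valid_window q" "w \<in> V" "t \<le> time w"
  shows "valid_window (delay gap L w t q)"
proof -
  obtain a l h where q: "q = (a, l, h)"
    by (cases q)
  have window: "a \<in> V" "agent a = 0" "l \<le> time a" "time a \<le> h"
    using assms(1) by (auto simp: q)
  have "2 * t + gap a w - L \<le> time a" if "\<not> l + gap a w \<le> L"
  proof -
    have "real_of_int L < time a + gap a w"
      using that window(3) by linarith
    then have "time w \<le> time a"
      using gap_le_if_queen_first[OF window(1) assms(2) window(2)] by linarith
    from gap_le_if_queen_second[OF assms(2) window(1,2) this] assms(3) show ?thesis
      by (simp add: gap_commute[of w])
  qed
  then show ?thesis
    using window by (auto simp: q delay_def max_def)
qed

lemma not_too_far:
  assumes "valid_visit s" "w \<in> V" "t \<le> time w"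
  shows "\<not> too_far gap L w t s"
proof -
  obtain z u where s: "s = (z, u)"
    by (cases s)
  have visit: "z \<in> V" "u \<le> time z"
    using assms(1) by (auto simp: s)
  have "2 * real_of_int (min t u) + gap w z \<le> 2 * L"
    using gap_le_two_visits[OF assms(2) visit(1)] assms(3) visit(2)
    by (auto simp: min_def split: if_splits)
  then show ?thesis
    unfolding s too_far_def by simp
qed

definition search_state ::
  "'v window list \<Rightarrow> 'v visit list \<Rightarrow> ('v \<Rightarrow> int) \<Rightarrow> nat \<Rightarrow> nat \<Rightarrow> 'v list \<Rightarrow> bool" where
  "search_state Q S earliest need b R \<longleftrightarrow>
     distinct R \<and> set R \<subseteq> V \<and> (\<forall>q\<in>set Q. valid_window q) \<and> (\<forall>s\<in>set S. valid_visit s) \<and>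
     (\<forall>r\<in>set R. agent r = b \<longrightarrow> earliest r \<le> time r) \<and> need \<le> card {r \<in> set R. agent r = b}"

lemma search_state_visit:
  assumes state: "search_state Q S earliest need b R" and "r \<in> set R" "agent r = b"
    and refuted: "refute_servants gap \<delta> L Q S earliest need n R"
  obtains w where "w \<in> set R"
    and "search_state (map (delay gap L w (earliest w)) Q) ((w, earliest w) # S)
      (\<lambda>v. earliest w + gap w v) (need - 1) b (remove1 w R)"
    and "refute_servants gap \<delta> L (map (delay gap L w (earliest w)) Q)
      ((w, earliest w) # S) (\<lambda>v. earliest w + gap w v) (need - 1) n (remove1 w R)"
proof -
  have vertices: "distinct R" "set R \<subseteq> V"
    and windows: "\<forall>q\<in>set Q. valid_window q" and visits: "\<forall>s\<in>set S. valid_visit s"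
    and earliest: "\<And>r. r \<in> set R \<Longrightarrow> agent r = b \<Longrightarrow> earliest r \<le> time r"
    and need: "need \<le> card {r \<in> set R. agent r = b}"
    using state by (auto simp: search_state_def)
  obtain w where w: "w \<in> set R" "agent w = b"
    and first: "\<And>r. r \<in> set R \<Longrightarrow> agent r = b \<Longrightarrow> time w \<le> time r"
    using ex_first_visit[of "set R" r b] assms(2,3) by auto
  let ?t = "earliest w"
  let ?Q = "map (delay gap L w ?t) Q"
  have reach_w: "w \<in> V" "?t \<le> time w"
    using w vertices(2) earliest by auto
  have next_windows: "\<forall>q\<in>set ?Q. valid_window q"
    using valid_window_delay[OF _ reach_w] windows by auto
  have "?t + (int need - 1) * \<delta> \<le> L"
    using tour_time_le[OF vertices(2) w _ need] reach_w(2) first by (meson order_trans)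
  moreover have "\<not> list_ex (too_far gap L w ?t) S"
    using not_too_far[OF _ reach_w] visits by (auto simp: list_ex_iff)
  moreover have "\<not> list_ex (\<lambda>(a, l, h). h < l) ?Q"
    using next_windows by (fastforce simp: list_ex_iff)
  ultimately have next_refuted:
    "refute_servants gap \<delta> L ?Q ((w, ?t) # S) (\<lambda>v. ?t + gap w v) (need - 1) n (remove1 w R)"
    using refute_servants_visitD[OF refuted w(1)] by linarith
  have "?t + gap w r \<le> time r" if "r \<in> set R" "r \<noteq> w" "agent r = b" for r
    using gap_le_if_same_agent[of w r] first[OF that(1,3)] w reach_w that vertices(2) by auto
  moreover have "{r \<in> set R - {w}. agent r = b} = {r \<in> set R. agent r = b} - {w}"
    by auto
  then have "need - 1 \<le> card {r \<in> set R - {w}. agent r = b}"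
    using need w by simp
  ultimately have "search_state ?Q ((w, ?t) # S) (\<lambda>v. ?t + gap w v) (need - 1) b (remove1 w R)"
    unfolding search_state_def using vertices visits next_windows reach_w by auto
  then show ?thesis
    using that w(1) next_refuted by blast
qed

lemma search_state_next:
  assumes "distinct R" "set R \<subseteq> V" "\<forall>q\<in>set Q. valid_window q" "\<forall>s\<in>set S. valid_visit s"
    and "finite A" "A \<noteq> {}" "\<forall>r\<in>set R. agent r \<in> A"
  obtains b where "b \<in> A" "search_state Q S (\<lambda>v. 0) (ceil_div (length R) (card A)) b R"
proof -
  obtain b where "b \<in> A" "ceil_div (length R) (card A) \<le> card {r \<in> set R. agent r = b}"
    using pigeonhole_ceil_div[of "set R" A agent] assms(5-7) distinct_card[OF assms(1)] by auto
  moreover have "\<forall>r\<in>set R. 0 \<le> time r"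
    using time_nonneg assms(2) by auto
  ultimately show ?thesis
    using that assms(1-4) by (simp add: search_state_def)
qed

lemma refute_servants_sound:
  assumes "refute_servants gap \<delta> L Q S earliest need n R" "search_state Q S earliest need b R"
    and "finite A" "card A = n" "b \<in> A" "\<forall>r\<in>set R. agent r \<in> A"
  shows False
  using assms
proof (induction Q S earliest need n R arbitrary: A b
    rule: refute_servants.induct[where gap = gap and L = L])
  case (1 Q S earliest need n R)
  note state = "1.prems"(2)
  show ?case
  proof (cases "\<exists>r\<in>set R. agent r = b")
    case True
    then obtain r where "r \<in> set R" "agent r = b"
      by blast
    from state this "1.prems"(1) show ?thesis
    proof (rule search_state_visit)
      fix w assume w: "w \<in> set R"
        and next_state: "search_state (map (delay gap L w (earliest w)) Q) ((w, earliest w) # S)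
          (\<lambda>v. earliest w + gap w v) (need - 1) b (remove1 w R)"
        and refuted: "refute_servants gap \<delta> L (map (delay gap L w (earliest w)) Q)
          ((w, earliest w) # S) (\<lambda>v. earliest w + gap w v) (need - 1) n (remove1 w R)"
      have "\<forall>r\<in>set (remove1 w R). agent r \<in> A"
        using "1.prems"(6) by (meson notin_set_remove1)
      then show False
        by (rule "1.IH"(1)[OF w refl refl refuted next_state "1.prems"(3-5)])
    qed
  next
    case False
    then have none: "{r \<in> set R. agent r = b} = {}"
      by blast
    have "need = 0"
      using state unfolding search_state_def none by simp
    then have "1 < n" and refuted:
      "refute_servants gap \<delta> L Q S (\<lambda>v. 0) (ceil_div (length R) (n - 1)) (n - 1) R"
      using refute_servants_nextD "1.prems"(1) by blast+
    let ?A = "A - {b}"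
    have others: "finite ?A" "card ?A = n - 1" "\<forall>r\<in>set R. agent r \<in> ?A"
      using "1.prems"(3-6) False by auto
    moreover have "?A \<noteq> {}"
      using others(2) \<open>1 < n\<close> by (metis card.empty less_irrefl zero_less_diff)
    ultimately obtain b' where "b' \<in> ?A"
      and "search_state Q S (\<lambda>v. 0) (ceil_div (length R) (n - 1)) b' R"
      using search_state_next[of R Q S ?A] state by (auto simp: search_state_def)
    then show ?thesis
      by (intro "1.IH"(2)[OF \<open>1 < n\<close> refuted _ others(1,2) _ others(3)])
  qed
qed

text \<open>
  With the Queen at \<open>c\<close> and her tour still open, \<open>h\<close> is the deadline for \<open>a\<close> in the extreme case that
  she reaches \<open>c\<close> only at time \<open>L\<close>.
\<close>

fun pending_window :: "'v \<Rightarrow> 'v window \<Rightarrow> bool" where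
  "pending_window c (a, l, h) \<longleftrightarrow> a \<in> V \<and> agent a = 0 \<and> l \<le> time a \<and> time a + L \<le> time c + h"

lemma valid_window_if_pending:
  assumes "c \<in> V" "pending_window c q"
  shows "valid_window q"
  using assms(2) time_le[OF assms(1)] by (cases q) auto

lemma pending_window_advance:
  assumes "pending_window c q" "time c + g \<le> time w"
  shows "pending_window w (advance g q)"
  using assms by (cases q) (auto simp: advance_def)

lemma refute_tours_sound:
  assumes "refute_tours gap \<delta> L k Q c t R" "0 < k" "distinct R" "set R \<subseteq> V"
    and "\<forall>q\<in>set ((c, t, L) # Q). pending_window c q"
    and "\<forall>r\<in>set R. agent r = 0 \<longrightarrow> time c \<le> time r"
  shows False
  using assms(1,3-)
proof (induction "length R" arbitrary: Q c t R rule: less_induct)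
  case less
  have refuted: "refute_servants gap \<delta> L ((c, t, L) # Q) [] (\<lambda>v. 0) (ceil_div (length R) k) k R"
    and step: "\<And>w. w \<in> set R \<Longrightarrow> L < t + gap c w \<or> refute_tours gap \<delta> L k
        (map (advance (gap c w)) ((c, t, L) # Q)) w (t + gap c w) (remove1 w R)"
    using iffD1[OF refute_tours.simps less.prems(1)] unfolding list_all_iff Let_def by blast+
  have queen_at_c: "c \<in> V" "agent c = 0" "t \<le> time c"
    using less.prems(4) by auto
  show ?case
  proof (cases "\<exists>r\<in>set R. agent r = 0")
    case True
    then obtain w where w: "w \<in> set R" "agent w = 0"
      and first: "\<And>r. r \<in> set R \<Longrightarrow> agent r = 0 \<Longrightarrow> time w \<le> time r"
      using ex_first_visit[of "set R" _ 0] by auto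
    have "w \<in> V"
      using w(1) less.prems(3) by auto
    then have travel: "time c + gap c w \<le> time w"
      using gap_le_if_same_agent[OF queen_at_c(1), of w] less.prems(5) w queen_at_c(2) by simp
    have "\<not> L < t + gap c w"
      using travel queen_at_c(3) time_le[OF \<open>w \<in> V\<close>] by linarith
    then have next_refuted: "refute_tours gap \<delta> L k (map (advance (gap c w)) ((c, t, L) # Q)) w
        (t + gap c w) (remove1 w R)"
      using step[OF w(1)] by blast
    show ?thesis
    proof (rule less.hyps[OF _ next_refuted])
      show "length (remove1 w R) < length R"
        using w(1) by (rule length_remove1_less)
      show "\<forall>q\<in>set ((w, t + gap c w, L) # map (advance (gap c w)) ((c, t, L) # Q)).
          pending_window w q"
        using less.prems(4) travel queen_at_c(3) w(2) \<open>w \<in> V\<close> by (auto intro!: pending_window_advance)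
    qed (use less.prems(2,3) \<open>w \<in> V\<close> first in auto)
  next
    case False
    then have agents: "\<forall>r\<in>set R. agent r \<in> {1..k}"
      using agent_le by (auto simp: Suc_le_eq)
    have windows: "\<forall>q\<in>set ((c, t, L) # Q). valid_window q"
      using less.prems(4) valid_window_if_pending[OF queen_at_c(1)] by blast
    obtain b where "b \<in> {1..k}"
      "search_state ((c, t, L) # Q) [] (\<lambda>v. 0) (ceil_div (length R) k) b R"
      using search_state_next[OF less.prems(2,3) windows _ _ _ agents, of "[]"] assms(2) by auto
    then show ?thesis
      using refute_servants_sound[OF refuted _ _ _ _ agents] by simp
  qed
qed

lemma refute_tours_from_first_visit:
  assumes "refute_tours gap \<delta> L k [] c 0 R" "0 < k" "distinct R" "set R \<subseteq> V"
    and "c \<in> V" "agent c = 0" "\<And>r. r \<in> V \<Longrightarrow> agent r = 0 \<Longrightarrow> time c \<le> time r"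
  shows False
  by (rule refute_tours_sound[OF assms(1-4)]) (use assms(4-) time_nonneg in auto)

end

subsection \<open>Regular dodecagons\<close>

text \<open>
  Times and distances are integers in units of \<open>10\<^sup>-\<^sup>6\<close>. Distances are rounded down, which keeps all
  constraints valid.
\<close>

definition dodecagon_chord :: "nat \<Rightarrow> int" where
  "dodecagon_chord m = [0, 517638, 1000000, 1414213, 1732050, 1931851, 2000000,
     1931851, 1732050, 1414213, 1000000, 517638] ! m"

definition dodecagon_side :: int where
  "dodecagon_side = dodecagon_chord 1"

definition dodecagon_gap :: "nat \<Rightarrow> nat \<Rightarrow> int" where
  "dodecagon_gap i j = dodecagon_chord (if i < j then j - i else i - j)"

lemma dodecagon_gap_commute: "dodecagon_gap i j = dodecagon_gap j i"
  by (auto simp: dodecagon_gap_def)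

lemma dodecagon_gap_ge:
  assumes "i < 12" "j < 12" "i \<noteq> j"
  shows "dodecagon_side \<le> dodecagon_gap i j"
proof -
  have "dodecagon_side \<le> dodecagon_chord m" if "0 < m" "m < 12" for m
  proof -
    have "m \<in> {1, 2, 3, 4, 5, 6, 7, 8, 9, 10, 11}"
      using that by (simp, presburger)
    then show ?thesis
      by (auto simp: dodecagon_chord_def dodecagon_side_def)
  qed
  then show ?thesis
    using assms by (simp add: dodecagon_gap_def)
qed

lemma dodecagon_chord_le:
  assumes "m < 12"
  shows "dodecagon_chord m \<le> 1000000 * (2 * sin (pi * m / 12))"
proof -
  let ?s = "2 * sin (pi * m / 12)"
  have sqrt3_le: "sqrt 3 \<le> 1.7320509"
    by (rule real_le_lsqrt)
      (simp_all add: power2_eq_square del: divide_le_eq_numeral1 le_divide_eq_numeral1)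
  have sqrt3_ge: "1.73205 \<le> sqrt 3"
    by (rule real_le_rsqrt) (simp add: power2_eq_square)
  have cos_values: "cos (pi / 6) = sqrt 3 / 2" "cos (pi * 2 / 6) = 1 / 2" "cos (pi * 3 / 6) = 0"
    "cos (pi * 4 / 6) = - 1 / 2" "cos (pi * 5 / 6) = - sqrt 3 / 2" "cos (pi * 6 / 6) = - 1"
    using cos_30 cos_60 cos_pi_minus[of "pi / 3"] cos_pi_minus[of "pi / 6"]
    by (simp_all add: field_simps)
  have reflect: "cos (pi * real m / 6) = cos (pi * (12 - real m) / 6)"
    using cos_periodic[of "- (pi * real m / 6)"] by (simp add: field_simps)
  have "?s\<^sup>2 = 2 - 2 * cos (pi * m / 6)"
    using cos_double_sin[of "pi * m / 12"] by (simp add: power_mult_distrib)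
  moreover have "m \<in> {0, 1, 2, 3, 4, 5, 6, 7, 8, 9, 10, 11}"
    using assms by (simp, presburger)
  then have "(dodecagon_chord m / 1000000)\<^sup>2 \<le> 2 - 2 * cos (pi * m / 6)"
    using sqrt3_le sqrt3_ge cos_values reflect
    by (elim insertE emptyE) (simp_all add: dodecagon_chord_def power2_eq_square)
  ultimately have "(dodecagon_chord m / 1000000)\<^sup>2 \<le> ?s\<^sup>2"
    by simp
  moreover have "0 \<le> ?s"
    using assms by (auto intro!: sin_ge_zero simp: field_simps)
  ultimately have "dodecagon_chord m / 1000000 \<le> ?s"
    by (rule power2_le_imp_le)
  then show ?thesis
    by simp
qed

lemma dodecagon_gap_le_norm:
  assumes "i < 12" "j < 12"
  shows "dodecagon_gap i j \<le>
    1000000 * norm (circle_point (polygon_angle 12 \<phi> i) - circle_point (polygon_angle 12 \<phi> j))"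
proof -
  let ?m = "if i < j then j - i else i - j"
  have "?m < 12" "\<bar>real i - real j\<bar> = real ?m"
    using assms by auto
  then show ?thesis
    unfolding norm_polygon_diff[OF assms] dodecagon_gap_def using dodecagon_chord_le[of ?m] by simp
qed

context evacuation
begin

lemma schedule_dodecagon:
  assumes unvisited: "\<And>i. t \<le> T (polygon_angle 12 \<phi> i)" and budget: "1000000 * (C - t) \<le> real_of_int L"
  shows "schedule dodecagon_gap dodecagon_side L {..<12} k
    (\<lambda>i. 1000000 * (T (polygon_angle 12 \<phi> i) - t)) (\<lambda>i. finder (polygon_angle 12 \<phi> i))"
proof
  let ?ang = "polygon_angle 12 \<phi>"
  let ?X = "\<lambda>i. 1000000 * (T (?ang i) - t)"
  show "finite {..<12::nat}" "0 < dodecagon_side"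
    by (simp_all add: dodecagon_side_def dodecagon_chord_def)
  show "dodecagon_gap i j = dodecagon_gap j i" for i j
    by (rule dodecagon_gap_commute)
  show "finder (?ang i) \<le> k" for i
    by (rule finder_le)
  fix i j :: nat assume ij: "i \<in> {..<12}" "j \<in> {..<12}"
  then have gap: "dodecagon_gap i j \<le> 1000000 * norm (circle_point (?ang i) - circle_point (?ang j))"
    using dodecagon_gap_le_norm by simp
  show "dodecagon_side \<le> dodecagon_gap i j" if "i \<noteq> j"
    using ij that dodecagon_gap_ge by simp
  show "0 \<le> ?X i"
    using unvisited by simp
  show "?X i \<le> L"
    using T_less[of "?ang i"] budget by (simp add: right_diff_distrib)
  show "dodecagon_gap i j \<le> \<bar>?X i - ?X j\<bar>" if "finder (?ang i) = finder (?ang j)"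
    using dist_le_if_same_finder[OF that] gap unfolding right_diff_distrib[symmetric] abs_mult by simp
  show "?X i + dodecagon_gap i j \<le> L" if "finder (?ang i) = 0" "?X i \<le> ?X j"
    using dist_less_if_queen_first[of "?ang i" "?ang j"] that gap budget by simp
  show "2 * ?X i + dodecagon_gap i j \<le> L + ?X j" if "finder (?ang j) = 0" "?X i \<le> ?X j"
    using dist_less_if_queen_second[of "?ang j" "?ang i"] that gap budget by simp
  show "2 * min (?X i) (?X j) + dodecagon_gap i j \<le> 2 * L"
    using dist_less_two_visits[of "?ang i" "?ang j"] gap budget
    by (simp add: min_def right_diff_distrib split: if_splits)
qed

lemma not_refute_tours_dodecagon:
  assumes "0 < k" "1 \<le> t" "(real k + 1) * (t - 1) < pi / 6" "1000000 * (C - t) \<le> real_of_int L"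
    and short: "L < (int (ceil_div 12 k) - 1) * dodecagon_side"
  shows "\<not> refute_tours dodecagon_gap dodecagon_side L k [] 0 0 [1..<12]"
proof
  assume refuted: "refute_tours dodecagon_gap dodecagon_side L k [] 0 0 [1..<12]"
  obtain \<phi> where unvisited: "\<And>i. t \<le> T (polygon_angle 12 \<phi> i)"
    using ex_unvisited_polygon[of 12 t] assms(2,3) by auto
  let ?ang = "polygon_angle 12 \<phi>"
  interpret original: schedule dodecagon_gap dodecagon_side L "{..<12}" k
    "\<lambda>i. 1000000 * (T (?ang i) - t)" "\<lambda>i. finder (?ang i)"
    by (rule schedule_dodecagon[OF unvisited assms(4)])
  obtain v where "v \<in> {..<12}" "finder (?ang v) = 0"
    using original.ex_queen_visit[OF assms(1)] short by (auto simp: lessThan_empty_iff)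
  then obtain j where queen_j: "finder (?ang j) = 0"
    and first: "\<And>i. i \<in> {..<12} \<Longrightarrow> finder (?ang i) = 0 \<Longrightarrow> T (?ang j) \<le> T (?ang i)"
    using original.ex_first_visit[of "{..<12}" v 0] by auto
  have first_of_all: "T (?ang j) \<le> T (?ang i)" if "finder (?ang i) = 0" for i
    using first[of "i mod 12"] that by (simp add: T_polygon_angle_mod finder_polygon_angle_mod)
  let ?rotated = "polygon_angle 12 (?ang j)"
  have queen_first: "finder (?rotated 0) = 0"
    "\<And>i. finder (?rotated i) = 0 \<Longrightarrow> T (?rotated 0) \<le> T (?rotated i)"
    using queen_j first_of_all by (simp_all add: polygon_angle_add)
  have "t \<le> T (?rotated i)" for i
    unfolding polygon_angle_add by (rule unvisited)
  then interpret rotated: schedule dodecagon_gap dodecagon_side L "{..<12}" k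
    "\<lambda>i. 1000000 * (T (?rotated i) - t)" "\<lambda>i. finder (?rotated i)"
    using assms(4) by (rule schedule_dodecagon)
  show False
    by (rule rotated.refute_tours_from_first_visit[OF refuted assms(1)]) (use queen_first in auto)
qed

end

text \<open>
  The time available after the start \<open>t\<close> is \<open>C - t\<close>, in units of \<open>10\<^sup>-\<^sup>6\<close>: here \<open>t = 1.261799\<close> is just
  below \<open>1 + \<pi>/12\<close>, and \<open>t = 1.17452\<close> just below \<open>1 + \<pi>/18\<close>.
\<close>

lemma refute_tours_one_servant:
  "refute_tours dodecagon_gap dodecagon_side 3384861 1 [] 0 0 [1..<12]"
  by code_simp

lemma refute_tours_two_servants:
  "refute_tours dodecagon_gap dodecagon_side 2478800 2 [] 0 0 [1..<12]"
  by code_simp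

theorem theorem2:
  shows "(\<forall>\<tau>. feasible 1 \<tau> \<longrightarrow> evac_cost 1 \<tau> \<ge> ereal 4.64666) \<and>
         (\<forall>\<tau>. feasible 2 \<tau> \<longrightarrow> evac_cost 2 \<tau> \<ge> ereal 3.65332)"
proof (intro conjI allI impI; rule ccontr)
  fix \<tau> assume "feasible 1 \<tau>" "\<not> evac_cost 1 \<tau> \<ge> ereal 4.64666"
  then interpret evacuation 1 \<tau> "4.64666"
    by unfold_locales auto
  have "\<not> refute_tours dodecagon_gap dodecagon_side 3384861 1 [] 0 0 [1..<12]"
    by (rule not_refute_tours_dodecagon[where t = "1.261799"])
      (use pi_approx(1) in \<open>auto simp: ceil_div_def dodecagon_side_def dodecagon_chord_def\<close>)
  then show False
    using refute_tours_one_servant by contradiction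
next
  fix \<tau> assume "feasible 2 \<tau>" "\<not> evac_cost 2 \<tau> \<ge> ereal 3.65332"
  then interpret evacuation 2 \<tau> "3.65332"
    by unfold_locales auto
  have "\<not> refute_tours dodecagon_gap dodecagon_side 2478800 2 [] 0 0 [1..<12]"
    by (rule not_refute_tours_dodecagon[where t = "1.17452"])
      (use pi_approx(1) in \<open>auto simp: ceil_div_def dodecagon_side_def dodecagon_chord_def\<close>)
  then show False
    using refute_tours_two_servants by contradiction
qed

end
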